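(* Let $d$ be a positive integer and $\chi$ a primitive Dirichlet character of conductor $d$. Let $w_1,w_2,w_3$ be any positive integers, $y\in\mathbb{Z}_p$, and $n\ge0$ an integer. Then \begin{align*} &\sum_{k+l+m=n}\binom{n}{k,l,m}B_{k,\chi}(w_{1}y)B_{l,\chi}(w_{2}y)B_{m,\chi}(w_{3}y)w_{3}^{k}w_{1}^{l}w_{2}^{m}\\ =&\sum_{k+l+m=n}\binom{n}{k,l,m}B_{k,\chi}(w_{1}y)B_{l,\chi}(w_{3}y)B_{m,\chi}(w_{2}y)w_{2}^{k}w_{1}^{l}w_{3}^{m}. \end{align*}
   Context: $p$ is a fixed prime, $\mathbb{Z}_p$ the $p$-adic integers; algebraic numbers are viewed in $\mathbb{C}_p$ via a fixed embedding $\overline{\mathbb{Q}}\to\mathbb{C}_p$. The character $\chi$ is regarded as a function on integers (periodic mod $d$, with $\chi(a)=0$ when $\gcd(a,d)>1$; for $d=1$, $\chi\equiv 1$). The generalized Bernoulli polynomials are defined by $\frac{te^{xt}}{e^{dt}-1}\sum_{a=0}^{d-1}\chi(a)e^{at}=\sum_{n\ge0}B_{n,\chi}(x)\frac{t^n}{n!}$. Sums are over nonnegative integers $k,l,m$ with $k+l+m=n$, and $\binom{n}{k,l,m}=\frac{n!}{k!l!m!}$. *)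

theory Defs
  imports
    "HOL-Analysis.Abstract_Metric_Spaces"
    "HOL-Computational_Algebra.Computational_Algebra"
    "HOL-Number_Theory.Cong"
begin

section \<open>The field of \<open>p\<close>-adic complex numbers\<close>

text \<open>
  An absolute value \<open>v\<close> on a field makes it a metric space. As the field below is complete,
  \<open>\<rat>\<^sub>p\<close>, the completion of \<open>\<rat>\<close>, is the closure of \<open>\<rat>\<close> in it.
\<close>

abbreviation absval_dist :: "('a :: field_char_0 \<Rightarrow> real) \<Rightarrow> 'a \<Rightarrow> 'a \<Rightarrow> real"
  where "absval_dist v \<equiv> (\<lambda>x y. v (x - y))"

definition padic_numbers :: "('a :: field_char_0 \<Rightarrow> real) \<Rightarrow> 'a set"
  where "padic_numbers v = Metric_space.mtopology UNIV (absval_dist v) closure_of \<rat>"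

definition padic_integers :: "('a :: field_char_0 \<Rightarrow> real) \<Rightarrow> 'a set"
  where "padic_integers v = {x \<in> padic_numbers v. v x \<le> 1}"

definition padic_algebraic :: "('a :: field_char_0 \<Rightarrow> real) \<Rightarrow> 'a set"
  where "padic_algebraic v =
    {x. \<exists>f. f \<noteq> 0 \<and> (\<forall>i. coeff f i \<in> padic_numbers v) \<and> poly f x = 0}"

text \<open>
  The locale says that the type \<open>'a\<close> with the absolute value \<open>v\<close> is a completion of an
  algebraic closure of \<open>\<rat>\<^sub>p\<close>. This determines \<open>('a, v)\<close> up to isometric isomorphism.
  The first four assumptions force \<open>v\<close> to be the \<open>p\<close>-adic absolute value on \<open>\<rat>\<close>.
\<close>

locale padic_complex_field =
  fixes p :: nat and v :: "'a :: field_char_0 \<Rightarrow> real"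
  assumes absval_nonneg: "v x \<ge> 0"
    and absval_eq_0_iff: "v x = 0 \<longleftrightarrow> x = 0"
    and absval_mult: "v (x * y) = v x * v y"
    and absval_ultrametric: "v (x + y) \<le> max (v x) (v y)"
    and absval_p: "v (of_nat p) = 1 / real p"
    and complete: "Metric_space.mcomplete UNIV (absval_dist v)"
    and algebraic_closed:
      "\<lbrakk>degree f > 0; \<forall>i. coeff f i \<in> padic_algebraic v\<rbrakk> \<Longrightarrow> \<exists>x \<in> padic_algebraic v. poly f x = 0"
    and algebraic_dense:
      "Metric_space.mtopology UNIV (absval_dist v) closure_of (padic_algebraic v) = UNIV"
begin

lemma absval_1: "v 1 = 1"
  using absval_mult[of 1 1] absval_eq_0_iff[of 1] by simp

lemma absval_minus: "v (- x) = v x"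
proof -
  have "(v (-1))\<^sup>2 = 1"
    using absval_mult[of "-1" "-1"] absval_1 by (simp add: power2_eq_square)
  then have "v (-1) = 1"
    using absval_nonneg[of "-1"] by (auto simp: power2_eq_1_iff)
  then show ?thesis
    using absval_mult[of "-1" x] by simp
qed

sublocale Metric_space UNIV "absval_dist v"
proof
  fix x y z :: 'a
  show "0 \<le> v (x - y)" by (rule absval_nonneg)
  show "v (x - y) = v (y - x)" using absval_minus[of "x - y"] by simp
  show "v (x - y) = 0 \<longleftrightarrow> x = y" by (simp add: absval_eq_0_iff)
  have "v (x - z) \<le> max (v (x - y)) (v (y - z))"
    using absval_ultrametric[of "x - y" "y - z"] by simp
  also have "\<dots> \<le> v (x - y) + v (y - z)"
    using absval_nonneg[of "x - y"] absval_nonneg[of "y - z"] by simp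
  finally show "v (x - z) \<le> v (x - y) + v (y - z)" .
qed

end

text \<open>
  The algebraic closure of \<open>\<rat>\<close> is the set of algebraic complex numbers. The values of \<open>\<iota>\<close>
  elsewhere are irrelevant. Injectivity on the algebraic numbers is automatic.
\<close>

definition algebraic_embedding :: "(complex \<Rightarrow> 'a :: field_char_0) \<Rightarrow> bool"
  where "algebraic_embedding \<iota> \<longleftrightarrow> \<iota> 1 = 1 \<and>
    (\<forall>x y. algebraic x \<longrightarrow> algebraic y \<longrightarrow> \<iota> (x + y) = \<iota> x + \<iota> y \<and> \<iota> (x * y) = \<iota> x * \<iota> y)"

section \<open>Dirichlet characters\<close>

definition dirichlet_character :: "nat \<Rightarrow> (int \<Rightarrow> complex) \<Rightarrow> bool"
  where "dirichlet_character d chi \<longleftrightarrow>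
    chi 1 = 1 \<and>
    (\<forall>a b. chi (a * b) = chi a * chi b) \<and>
    (\<forall>a. chi (a + int d) = chi a) \<and>
    (\<forall>a. chi a = 0 \<longleftrightarrow> \<not> coprime a (int d))"

text \<open>
  The conductor is the least divisor \<open>m\<close> of \<open>d\<close> such that \<open>chi\<close> on \<open>(\<int>/d)\<^sup>*\<close> factors
  through \<open>(\<int>/m)\<^sup>*\<close>, that is, such that \<open>chi\<close> is trivial on the kernel of the reduction map.
\<close>

definition conductor :: "nat \<Rightarrow> (int \<Rightarrow> complex) \<Rightarrow> nat"
  where "conductor d chi = (LEAST m. m > 0 \<and> m dvd d \<and>
    (\<forall>a. coprime a (int d) \<longrightarrow> [a = 1] (mod int m) \<longrightarrow> chi a = 1))"

definition primitive_character :: "nat \<Rightarrow> (int \<Rightarrow> complex) \<Rightarrow> bool"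
  where "primitive_character d chi \<longleftrightarrow> dirichlet_character d chi \<and> conductor d chi = d"

section \<open>Generalized Bernoulli polynomials\<close>

text \<open>
  The value at \<open>x\<close>. Both \<open>t e\<^bsup>xt\<^esup>\<close> and \<open>e\<^bsup>dt\<^esup> - 1\<close> have order 1 in \<open>t\<close>, so the quotient of
  formal power series is exact although the denominator is not a unit.
\<close>

definition gen_bernoulli_gf :: "nat \<Rightarrow> (int \<Rightarrow> 'a :: field_char_0) \<Rightarrow> 'a \<Rightarrow> 'a fps"
  where "gen_bernoulli_gf d chi x =
    fps_X * fps_exp x / (fps_exp (of_nat d) - 1) *
    (\<Sum>a<d. fps_const (chi (int a)) * fps_exp (of_nat a))"

definition gen_bernoulli :: "nat \<Rightarrow> (int \<Rightarrow> 'a :: field_char_0) \<Rightarrow> nat \<Rightarrow> 'a \<Rightarrow> 'a"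
  where "gen_bernoulli d chi n x = fact n * fps_nth (gen_bernoulli_gf d chi x) n"

lemma gen_bernoulli_gf_exact:
  fixes x :: "'a :: field_char_0"
  assumes "d > 0"
  shows "gen_bernoulli_gf d chi x * (fps_exp (of_nat d) - 1) =
    fps_X * fps_exp x * (\<Sum>a<d. fps_const (chi (int a)) * fps_exp (of_nat a))"
proof -
  define g :: "'a fps" where "g = fps_exp (of_nat d) - 1"
  define f where "f = fps_X * fps_exp x"
  have g1: "fps_nth g 1 \<noteq> 0" and g0: "fps_nth g 0 = 0"
    using assms by (simp_all add: g_def)
  have "subdegree g = 1"
    using g1 g0 by (intro subdegreeI) auto
  moreover have f1: "fps_nth f 1 \<noteq> 0" and f0: "fps_nth f 0 = 0"
    by (simp_all add: f_def)
  have "subdegree f = 1"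
    using f1 f0 by (intro subdegreeI) auto
  moreover have "g \<noteq> 0"
    using g1 by auto
  ultimately have "f / g * g = f"
    by (intro fps_times_divide_eq) simp_all
  then have "f / g * s * g = f * s" for s
    by (metis mult.assoc mult.commute)
  then show ?thesis
    unfolding gen_bernoulli_gf_def f_def g_def .
qed

definition multinomial3 :: "nat \<Rightarrow> nat \<Rightarrow> nat \<Rightarrow> 'a :: field_char_0"
  where "multinomial3 k l m = fact (k + l + m) / (fact k * fact l * fact m)"

end

theory Submission
  imports Defs
begin

text \<open>
  The factor \<open>e\<^bsup>xt\<^esup>\<close> splits off the generating function \<open>F\<^sub>x(t)\<close> of the \<open>B\<^sub>n(x)\<close>, so
  \<open>F\<^bsub>w\<^sub>1y\<^esub>(w\<^sub>3t) F\<^bsub>w\<^sub>2y\<^esub>(w\<^sub>1t) F\<^bsub>w\<^sub>3y\<^esub>(w\<^sub>2t) =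
  e\<^bsup>(w\<^sub>1w\<^sub>2 + w\<^sub>2w\<^sub>3 + w\<^sub>3w\<^sub>1)yt\<^esup> F\<^sub>0(w\<^sub>1t) F\<^sub>0(w\<^sub>2t) F\<^sub>0(w\<^sub>3t)\<close>.
  This is symmetric in the \<open>w\<^sub>i\<close>, and the two sides of the identity are the coefficients of such
  products.
\<close>

lemma fps_mult_nth_triple:
  fixes f g h :: "'a :: comm_semiring_1 fps"
  shows "fps_nth (f * g * h) n =
    (\<Sum>(k, l, m) \<in> {(k, l, m). k + l + m = n}. fps_nth f k * fps_nth g l * fps_nth h m)"
proof -
  have "fps_nth (f * g * h) n =
      (\<Sum>j=0..n. \<Sum>k=0..j. fps_nth f k * fps_nth g (j - k) * fps_nth h (n - j))"
    by (simp add: fps_mult_nth sum_distrib_right)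
  also have "\<dots> = (\<Sum>(j, k) \<in> (SIGMA j:{0..n}. {0..j}).
      fps_nth f k * fps_nth g (j - k) * fps_nth h (n - j))"
    by (simp add: sum.Sigma)
  also have "\<dots> = (\<Sum>(k, l, m) \<in> {(k, l, m). k + l + m = n}.
      fps_nth f k * fps_nth g l * fps_nth h m)"
    \<comment> \<open>The outer index is \<open>k + l\<close>, the degree contributed by
      \<open>f * g\<close>.\<close>
    by (rule sum.reindex_bij_witness[where i = "\<lambda>(k, l, m). (k + l, k)"
          and j = "\<lambda>(j, k). (k, j - k, n - j)"]) auto
  finally show ?thesis .
qed

text \<open>Multiplying by \<open>fps_exp (of_nat d) - 1\<close> clears the denominator on both
  sides; this series is not a unit, but it is nonzero and can be cancelled.\<close>

lemma gen_bernoulli_gf_eq_exp_mult: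
  fixes x :: "'a :: field_char_0"
  assumes "d > 0"
  shows "gen_bernoulli_gf d chi x = fps_exp x * gen_bernoulli_gf d chi 0"
proof -
  let ?g = "fps_exp (of_nat d) - 1 :: 'a fps"
  have "fps_nth ?g 1 \<noteq> 0"
    using assms by simp
  then have "?g \<noteq> 0"
    by (metis fps_zero_nth)
  moreover have "gen_bernoulli_gf d chi x * ?g = fps_exp x * gen_bernoulli_gf d chi 0 * ?g"
    using gen_bernoulli_gf_exact[OF assms, of chi x] gen_bernoulli_gf_exact[OF assms, of chi 0]
    by (simp add: mult_ac)
  ultimately show ?thesis
    by simp
qed

text \<open>Substituting ct for t absorbs the powers of the weights in the sums.\<close>

definition gen_bernoulli_gf_scaled ::
    "nat \<Rightarrow> (int \<Rightarrow> 'a :: field_char_0) \<Rightarrow> 'a \<Rightarrow> 'a \<Rightarrow> 'a fps"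
  where "gen_bernoulli_gf_scaled d chi x c =
    fps_compose (gen_bernoulli_gf d chi x) (fps_const c * fps_X)"

lemma gen_bernoulli_gf_scaled_nth:
  "fps_nth (gen_bernoulli_gf_scaled d chi x c) n = gen_bernoulli d chi n x * c ^ n / fact n"
  by (simp add: gen_bernoulli_gf_scaled_def gen_bernoulli_def fps_compose_linear)

lemma gen_bernoulli_gf_scaled_eq_exp_mult:
  assumes "d > 0"
  shows "gen_bernoulli_gf_scaled d chi x c =
    fps_exp (c * x) * gen_bernoulli_gf_scaled d chi 0 c"
  unfolding gen_bernoulli_gf_scaled_def gen_bernoulli_gf_eq_exp_mult[OF assms, of chi x]
  by (simp add: fps_compose_mult_distrib)

text \<open>The factorials in \<open>multinomial3\<close> make the sum a Cauchy product of
  exponential generating functions.\<close>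

lemma sum_multinomial3_gen_bernoulli:
  fixes a b c r s t :: "'a :: field_char_0"
  shows "(\<Sum>(k, l, m) \<in> {(k, l, m). k + l + m = n}.
      multinomial3 k l m *
      gen_bernoulli d chi k a * gen_bernoulli d chi l b * gen_bernoulli d chi m c *
      r ^ k * s ^ l * t ^ m) =
    fact n * fps_nth (gen_bernoulli_gf_scaled d chi a r * gen_bernoulli_gf_scaled d chi b s *
      gen_bernoulli_gf_scaled d chi c t) n"
  unfolding fps_mult_nth_triple sum_distrib_left
  by (intro sum.cong refl) (auto simp: multinomial3_def gen_bernoulli_gf_scaled_nth field_simps)

theorem theorem7:
  fixes p d n w1 w2 w3 :: nat
    and v :: "'a :: field_char_0 \<Rightarrow> real"
    and \<iota> :: "complex \<Rightarrow> 'a"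
    and chi :: "int \<Rightarrow> complex"
    and y :: 'a
  assumes "prime p"
    and "padic_complex_field p v"
    and "algebraic_embedding \<iota>"
    and "d > 0"
    and "primitive_character d chi"
    and "w1 > 0" and "w2 > 0" and "w3 > 0"
    and "y \<in> padic_integers v"
  defines "B \<equiv> gen_bernoulli d (\<lambda>a. \<iota> (chi a))"
  shows
    "(\<Sum>(k, l, m) \<in> {(k, l, m). k + l + m = n}.
        multinomial3 k l m *
        B k (of_nat w1 * y) * B l (of_nat w2 * y) * B m (of_nat w3 * y) *
        of_nat w3 ^ k * of_nat w1 ^ l * of_nat w2 ^ m) =
     (\<Sum>(k, l, m) \<in> {(k, l, m). k + l + m = n}.
        multinomial3 k l m *
        B k (of_nat w1 * y) * B l (of_nat w3 * y) * B m (of_nat w2 * y) *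
        of_nat w2 ^ k * of_nat w1 ^ l * of_nat w3 ^ m)"
proof -
  let ?F = "gen_bernoulli_gf_scaled d (\<lambda>a. \<iota> (chi a))"
  \<comment> \<open>The form \<open>of_nat i * y\<close> keeps the rewriting from applying again to
    \<open>?F 0 c\<close>.\<close>
  have F: "?F (of_nat i * y) c = fps_exp (c * (of_nat i * y)) * ?F 0 c" for i c
    by (rule gen_bernoulli_gf_scaled_eq_exp_mult[OF \<open>d > 0\<close>])
  \<comment> \<open>The two sides of the theorem are the cases (w1, w2, w3) and (w1, w3, w2) of (i,
    j, k).\<close>
  have symmetric: "?F (of_nat i * y) (of_nat k) * ?F (of_nat j * y) (of_nat i) *
      ?F (of_nat k * y) (of_nat j) =
      fps_exp ((of_nat i * of_nat j + of_nat j * of_nat k + of_nat k * of_nat i) * y) *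
      (?F 0 (of_nat i) * ?F 0 (of_nat j) * ?F 0 (of_nat k))" for i j k
    unfolding F by (simp add: fps_exp_add_mult algebra_simps)
  have "?F (of_nat w1 * y) (of_nat w3) * ?F (of_nat w2 * y) (of_nat w1) *
      ?F (of_nat w3 * y) (of_nat w2) =
      ?F (of_nat w1 * y) (of_nat w2) * ?F (of_nat w3 * y) (of_nat w1) *
      ?F (of_nat w2 * y) (of_nat w3)"
    unfolding symmetric by (simp add: ac_simps)
  then show ?thesis
    unfolding B_def sum_multinomial3_gen_bernoulli by simp
qed

end
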